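(* Let $G=(V,E)$ be an infinite, connected, locally finite graph, and let $P=\Delta_{1,a}+W$ be a Schrödinger operator on $G$ (with $a:E\to\mathbb{R}_+^\star$ and $W:V\to\mathbb{R}$) such that $$\langle Pf,f\rangle_{l^2}>0\qquad\text{for every } f\in C_0(V)\setminus\{0\}.$$ Then there exists a strictly positive $P$-harmonic function on $V$, i.e. a function $\Phi:V\to\mathbb{R}$ with $\Phi(x)>0$ and $(P\Phi)(x)=0$ for every $x\in V$.
   Context: $G=(V,E)$ is a graph with vertex set $V$ and edge set $E$, whose edges are unordered pairs $\{x,y\}$ of distinct vertices; $x\sim y$ means $\{x,y\}\in E$. $\mathbb{R}_+^\star=(0,\infty)$. A function $a$ on $E$ is written $a_{x,y}=a_{y,x}$ for $\{x,y\}\in E$. $C_0(V)$ is the space of finitely supported functions $V\to\mathbb{R}$, and $\langle f,g\rangle_{l^2}=\sum_{x\in V}f(x)g(x)$. The Schrödinger operator $P=\Delta_{1,a}+W$ acts on any function $f:V\to\mathbb{R}$ by $$(Pf)(x)=\sum_{y\sim x}a_{x,y}(f(x)-f(y))+W(x)f(x)$$ (finite sums, as $G$ is locally finite). *)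

theory Defs
  imports "HOL-Analysis.Infinite_Sum"
begin

definition simple_graph :: "'v set \<Rightarrow> 'v set set \<Rightarrow> bool" where
  "simple_graph V E \<longleftrightarrow> (\<forall>e\<in>E. \<exists>x\<in>V. \<exists>y\<in>V. x \<noteq> y \<and> e = {x, y})"

definition adjacent :: "'v set set \<Rightarrow> 'v \<Rightarrow> 'v \<Rightarrow> bool" where
  "adjacent E x y \<longleftrightarrow> {x, y} \<in> E"

definition neighbours :: "'v set set \<Rightarrow> 'v \<Rightarrow> 'v set" where
  "neighbours E x = {y. adjacent E x y}"

definition locally_finite_graph :: "'v set \<Rightarrow> 'v set set \<Rightarrow> bool" where
  "locally_finite_graph V E \<longleftrightarrow> (\<forall>x\<in>V. finite (neighbours E x))"

definition connected_graph :: "'v set \<Rightarrow> 'v set set \<Rightarrow> bool" where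
  "connected_graph V E \<longleftrightarrow> (\<forall>x\<in>V. \<forall>y\<in>V. (adjacent E)\<^sup>*\<^sup>* x y)"

text \<open>
  A function on \<open>V\<close> is a total function on the ambient type of which only the values on \<open>V\<close>
  matter; a function on the edges takes the edge, a two-element set, as its argument, so that
  \<open>a {x, y} = a {y, x}\<close> holds by construction.
\<close>

definition laplacian :: "'v set set \<Rightarrow> ('v set \<Rightarrow> real) \<Rightarrow> ('v \<Rightarrow> real) \<Rightarrow> 'v \<Rightarrow> real" where
  "laplacian E a f x = (\<Sum>y\<in>neighbours E x. a {x, y} * (f x - f y))"

definition schroedinger ::
    "'v set set \<Rightarrow> ('v set \<Rightarrow> real) \<Rightarrow> ('v \<Rightarrow> real) \<Rightarrow> ('v \<Rightarrow> real) \<Rightarrow> 'v \<Rightarrow> real" where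
  "schroedinger E a W f x = laplacian E a f x + W x * f x"

text \<open>
  Elements of \<open>C\<^sub>0(V)\<close> are represented by their extension by zero, so that each of them has
  exactly one representative and the zero function on \<open>V\<close> is \<open>\<lambda>_. 0\<close>.
\<close>

definition C0 :: "'v set \<Rightarrow> ('v \<Rightarrow> real) set" where
  "C0 V = {f. (\<forall>x. x \<notin> V \<longrightarrow> f x = 0) \<and> finite {x \<in> V. f x \<noteq> 0}}"

definition l2_inner :: "'v set \<Rightarrow> ('v \<Rightarrow> real) \<Rightarrow> ('v \<Rightarrow> real) \<Rightarrow> real" where
  "l2_inner V f g = (\<Sum>\<^sub>\<infinity>x\<in>V. f x * g x)"

text \<open>
  The default value of a non-convergent infinite sum plays no role when one argument is
  in \<open>C\<^sub>0(V)\<close>: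
\<close>

lemma l2_inner_C0:
  assumes "g \<in> C0 V"
  shows "l2_inner V f g = (\<Sum>x | x \<in> V \<and> g x \<noteq> 0. f x * g x)"
proof -
  have fin: "finite {x \<in> V. g x \<noteq> 0}"
    using assms by (simp add: C0_def)
  have "l2_inner V f g = (\<Sum>\<^sub>\<infinity>x\<in>{x \<in> V. g x \<noteq> 0}. f x * g x)"
    unfolding l2_inner_def by (rule infsum_cong_neutral) auto
  with fin show ?thesis by simp
qed

end

theory Submission
  imports Defs "HOL-Analysis.Function_Topology"
begin

text \<open>
  On a finite vertex set \<open>L\<close> the operator \<open>P\<close> is a positive definite matrix with nonpositive
  off-diagonal entries, so the Dirichlet problem on \<open>L\<close> with nonnegative data has a nonnegative
  solution; adding one vertex at a time (Schur complement) gives existence and sign together.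
  Hence for every finite \<open>K\<close> there is a nonnegative function that is harmonic on \<open>K\<close> and positive
  at a vertex just outside \<open>K\<close>; harmonicity propagates zeros, so it does not vanish at the base
  point \<open>p\<close> and can be normalised there. The Harnack inequality
  \<open>a {x, y} * u y \<le> D x * u x\<close> bounds the normalised functions pointwise, and Tychonoff's theorem
  yields a function that is harmonic everywhere.
\<close>

section \<open>Local estimates that need positive weights only: sign rule and Harnack
  inequality\<close>

locale weighted_graph =
  fixes V :: "'v set" and E :: "'v set set"
    and a :: "'v set \<Rightarrow> real" and W :: "'v \<Rightarrow> real"
  assumes simple: "simple_graph V E"
    and locally_finite: "locally_finite_graph V E"
    and weight_pos: "\<And>e. e \<in> E \<Longrightarrow> a e > 0"
begin

abbreviation P :: "('v \<Rightarrow> real) \<Rightarrow> 'v \<Rightarrow> real" where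
  "P \<equiv> schroedinger E a W"

definition D :: "'v \<Rightarrow> real" where
  "D x = (\<Sum>y\<in>neighbours E x. a {x, y}) + W x"

lemma finite_neighbours: "x \<in> V \<Longrightarrow> finite (neighbours E x)"
  using locally_finite by (simp add: locally_finite_graph_def)

lemma neighbours_subset: "neighbours E x \<subseteq> V"
  using simple by (fastforce simp: neighbours_def adjacent_def simple_graph_def doubleton_eq_iff)

lemma weight_neighbour_pos: "y \<in> neighbours E x \<Longrightarrow> a {x, y} > 0"
  using weight_pos by (simp add: neighbours_def adjacent_def)

lemma reachable_in_V: "(adjacent E)\<^sup>*\<^sup>* x y \<Longrightarrow> x \<in> V \<Longrightarrow> y \<in> V"
  by (induction rule: rtranclp_induct) (use neighbours_subset in \<open>auto simp: neighbours_def\<close>)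

lemma P_diag: "P f x = D x * f x - (\<Sum>y\<in>neighbours E x. a {x, y} * f y)"
  by (simp add: schroedinger_def laplacian_def D_def right_diff_distrib sum_subtractf
      sum_distrib_right distrib_right)

lemma P_linear: "P (\<lambda>y. f y + c * g y) x = P f x + c * P g x"
  by (simp add: P_diag algebra_simps sum.distrib sum_distrib_left)

lemma P_scale: "P (\<lambda>y. c * g y) x = c * P g x"
  by (simp add: P_diag algebra_simps sum_distrib_left)

lemma P_cong: "f x = g x \<Longrightarrow> (\<And>y. y \<in> neighbours E x \<Longrightarrow> f y = g y) \<Longrightarrow> P f x = P g x"
  by (simp add: P_diag)

text \<open>Off-diagonal entries are nonpositive, and at a zero of \<open>f\<close> they alone
  contribute.\<close>

lemma P_nonpos_at_zero: "f x = 0 \<Longrightarrow> (\<And>y. f y \<ge> 0) \<Longrightarrow> P f x \<le> 0"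
  by (simp add: P_diag sum_nonneg less_imp_le[OF weight_neighbour_pos])

text \<open>Harmonicity at \<open>x\<close> makes \<open>D x * u x\<close> a sum of nonnegative
  terms, which dominates each of them.\<close>

lemma harnack:
  assumes "x \<in> V" "y \<in> neighbours E x" "\<And>y. u y \<ge> 0" "P u x = 0"
  shows "a {x, y} * u y \<le> D x * u x"
proof -
  have "a {x, y} * u y \<le> (\<Sum>y\<in>neighbours E x. a {x, y} * u y)"
    using assms by (intro member_le_sum finite_neighbours)
      (simp_all add: less_imp_le[OF weight_neighbour_pos])
  with assms(4) show ?thesis by (simp add: P_diag)
qed

lemma zero_propagates:
  assumes "x \<in> V" "y \<in> neighbours E x" "\<And>y. u y \<ge> 0" "P u x = 0" "u x = 0"
  shows "u y = 0"
  using harnack[OF assms(1-4)] weight_neighbour_pos[OF assms(2)] assms(3)[of y] assms(5)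
  by (simp add: mult_le_0_iff)

text \<open>Harnack is iterated along a path from \<open>p\<close>. \<open>K\<close> collects the
  path vertices at which it is applied; \<open>K\<close> and \<open>C\<close> do not depend on
  \<open>u\<close>, which compactness requires later.\<close>

lemma harnack_chain:
  assumes "(adjacent E)\<^sup>*\<^sup>* p y" "p \<in> V"
  shows "\<exists>K C. finite K \<and> K \<subseteq> V \<and> C \<ge> 0 \<and>
    (\<forall>u. (\<forall>x. u x \<ge> 0) \<and> u p = 1 \<and> (\<forall>x\<in>K. P u x = 0) \<longrightarrow> u y \<le> C)"
  using assms(1)
proof (induction rule: rtranclp_induct)
  case base
  show ?case by (rule exI[of _ "{}"], rule exI[of _ 1]) auto
next
  case (step y z)
  from step.IH obtain K C where K: "finite K" "K \<subseteq> V" "C \<ge> 0"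
    and C: "\<forall>u. (\<forall>x. u x \<ge> 0) \<and> u p = 1 \<and> (\<forall>x\<in>K. P u x = 0) \<longrightarrow> u y \<le> C"
    by (elim exE conjE)
  have y: "y \<in> V" using reachable_in_V[OF step.hyps(1) assms(2)] .
  have z: "z \<in> neighbours E y" using step.hyps(2) by (simp add: neighbours_def)
  note az = weight_neighbour_pos[OF z]
  have "\<forall>u. (\<forall>x. u x \<ge> 0) \<and> u p = 1 \<and> (\<forall>x\<in>insert y K. P u x = 0) \<longrightarrow>
      u z \<le> \<bar>D y\<bar> * C / a {y, z}"
  proof (intro allI impI)
    fix u :: "'v \<Rightarrow> real"
    assume u: "(\<forall>x. u x \<ge> 0) \<and> u p = 1 \<and> (\<forall>x\<in>insert y K. P u x = 0)"
    have "u y \<le> C" using C u by simp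
    have "a {y, z} * u z \<le> D y * u y" using harnack[of y z u] y z u by simp
    \<comment> \<open>The absolute value makes the bound monotone in \<open>u y\<close>, as no sign
      of \<open>D y\<close> is known here.\<close>
    also have "\<dots> \<le> \<bar>D y\<bar> * C" using \<open>u y \<le> C\<close> u by (intro mult_mono) auto
    finally show "u z \<le> \<bar>D y\<bar> * C / a {y, z}" using az by (simp add: field_simps)
  qed
  moreover have "finite (insert y K)" "insert y K \<subseteq> V" "\<bar>D y\<bar> * C / a {y, z} \<ge> 0"
    using K y az by simp_all
  ultimately show ?case by (intro exI conjI)
qed

end

section \<open>The Dirichlet problem on finite vertex sets\<close>

locale positive_schroedinger = weighted_graph +
  assumes positive: "\<And>f. f \<in> C0 V \<Longrightarrow> f \<noteq> (\<lambda>_. 0) \<Longrightarrow> l2_inner V (P f) f > 0"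
begin

text \<open>The products \<open>P v x * v x\<close> vanish except at \<open>z\<close>, so the
  quadratic form at \<open>v\<close> reduces to \<open>P v z\<close>.\<close>

lemma P_pos_at_source:
  assumes L: "finite L" "L \<subseteq> V" and z: "z \<in> V" "v z = 1"
    and v: "\<And>x. x \<notin> insert z L \<Longrightarrow> v x = 0" "\<And>x. x \<in> L \<Longrightarrow> P v x = 0"
  shows "P v z > 0"
proof -
  have sub: "{x \<in> V. v x \<noteq> 0} \<subseteq> insert z L" using v(1) by blast
  have "v x = 0" if "x \<notin> V" for x
    using that L z v(1)[of x] by blast
  then have C0: "v \<in> C0 V"
    using L finite_subset[OF sub] by (simp add: C0_def)
  have "l2_inner V (P v) v = (\<Sum>x\<in>{x \<in> V. v x \<noteq> 0}. P v x * v x)"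
    by (rule l2_inner_C0[OF C0])
  also have "\<dots> = (\<Sum>x\<in>{z}. P v x * v x)"
    using z v sub L finite_subset[OF sub] by (intro sum.mono_neutral_right) auto
  finally have "l2_inner V (P v) v = P v z" using z(2) by simp
  moreover have "v \<noteq> (\<lambda>_. 0)" using z(2) by (metis zero_neq_one)
  ultimately show ?thesis using positive[OF C0] by simp
qed

lemma dirichlet_solution:
  assumes "finite L" "L \<subseteq> V" "\<And>x. x \<in> L \<Longrightarrow> g x \<ge> 0"
  shows "\<exists>u. (\<forall>x. u x \<ge> 0) \<and> (\<forall>x. x \<notin> L \<longrightarrow> u x = 0) \<and> (\<forall>x\<in>L. P u x = g x)"
  using assms
proof (induction L arbitrary: g rule: finite_induct)
  case empty
  show ?case by (rule exI[of _ "\<lambda>_. 0"]) simp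
next
  case (insert z L)
  define \<delta> :: "'a \<Rightarrow> real" where "\<delta> = (\<lambda>x. if x = z then 1 else 0)"
  have "- P \<delta> x \<ge> 0" if "x \<in> L" for x
  proof -
    have "\<delta> x = 0" "\<And>y. \<delta> y \<ge> 0" using insert.hyps that by (auto simp: \<delta>_def)
    then show ?thesis using P_nonpos_at_zero[of \<delta> x] by simp
  qed
  \<comment> \<open>The induction hypothesis serves twice, hence the arbitrary \<open>g\<close>:
    here it corrects \<open>\<delta>\<close> to a function harmonic on \<open>L\<close>, then it
    solves for the given data on \<open>L\<close>.\<close>
  then obtain w where w: "\<And>x. w x \<ge> 0" "\<And>x. x \<notin> L \<Longrightarrow> w x = 0"
      "\<And>x. x \<in> L \<Longrightarrow> P w x = - P \<delta> x"
    using insert.IH[of "\<lambda>x. - P \<delta> x"] insert.prems(1) by blast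
  obtain u where u: "\<And>x. u x \<ge> 0" "\<And>x. x \<notin> L \<Longrightarrow> u x = 0" "\<And>x. x \<in> L \<Longrightarrow> P u x = g x"
    using insert.IH[of g] insert.prems by blast
  define v where "v = (\<lambda>x. w x + 1 * \<delta> x)"
  have v: "v x \<ge> 0" for x using w(1) by (simp add: v_def \<delta>_def)
  have vL: "P v x = 0" if "x \<in> L" for x
    using w(3)[OF that] unfolding v_def P_linear by simp
  have v0: "v x = 0" if "x \<notin> insert z L" for x
    using that w(2) by (simp add: v_def \<delta>_def)
  have "v z = 1" using w(2) insert.hyps by (simp add: v_def \<delta>_def)
  then have Pvz: "P v z > 0"
    using P_pos_at_source[OF insert.hyps(1), of z v] insert.prems v0 vL by auto
  \<comment> \<open>Adding a multiple of \<open>v\<close> leaves the values of \<open>P\<close> on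
    \<open>L\<close> unchanged; \<open>c\<close> adjusts the value at \<open>z\<close>. Its
    denominator is the Schur complement, and its numerator is nonnegative because \<open>u\<close>
    vanishes at \<open>z\<close>.\<close>
  define c where "c = (g z - P u z) / P v z"
  have "P u z \<le> 0" using P_nonpos_at_zero[of u z] u insert.hyps by auto
  then have "c \<ge> 0"
    unfolding c_def using Pvz insert.prems(2)[of z] by (intro divide_nonneg_pos) auto
  moreover have "P (\<lambda>x. u x + c * v x) x = g x" if "x \<in> insert z L" for x
    unfolding P_linear using that Pvz u(3) vL by (auto simp: c_def)
  ultimately show ?case
    using u v v0 by (intro exI[of _ "\<lambda>x. u x + c * v x"]) auto
qed

text \<open>\<open>v\<close> is the Dirichlet Green function of \<open>insert z K\<close> with pole
  \<open>z\<close>; if it vanished at \<open>z\<close>, then \<open>P v z\<close> would be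
  nonpositive instead of 1.\<close>

lemma harmonic_with_source:
  assumes "finite K" "K \<subseteq> V" "z \<in> V" "z \<notin> K"
  obtains v where "\<And>x. v x \<ge> 0" "v z > 0" "\<And>x. x \<in> K \<Longrightarrow> P v x = 0"
proof -
  have "\<exists>v. (\<forall>x. v x \<ge> 0) \<and> (\<forall>x. x \<notin> insert z K \<longrightarrow> v x = 0) \<and>
      (\<forall>x\<in>insert z K. P v x = (if x = z then 1 else 0))"
    using assms by (intro dirichlet_solution) auto
  then obtain v where v: "\<forall>x. v x \<ge> 0" "\<forall>x\<in>insert z K. P v x = (if x = z then 1 else 0)"
    by blast
  have "v z \<noteq> 0" using P_nonpos_at_zero[of v z] v by auto
  then have "v z > 0" using v(1) by (simp add: less_le)
  moreover have "P v x = 0" if "x \<in> K" for x using v(2) assms(4) that by auto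
  ultimately show thesis using that v(1) by blast
qed

end

text \<open>The path is cut at its first vertex outside \<open>K\<close>. Only the source of each
  step must lie in \<open>K\<close>, which is where propagation of zeros needs harmonicity.\<close>

lemma rtranclp_exit:
  assumes "r\<^sup>*\<^sup>* x w" "w \<notin> K"
  obtains z where "(\<lambda>x y. x \<in> K \<and> r x y)\<^sup>*\<^sup>* x z" "z \<notin> K"
proof -
  let ?s = "\<lambda>x y. x \<in> K \<and> r x y"
  from assms(1) have "?s\<^sup>*\<^sup>* x w \<or> (\<exists>z. ?s\<^sup>*\<^sup>* x z \<and> z \<notin> K)"
  proof (induction rule: rtranclp_induct)
    case (step y z)
    then show ?case by (metis (mono_tags, lifting) rtranclp.rtrancl_into_rtrancl)
  qed simp
  with assms(2) that show thesis by blast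
qed

section \<open>Exhaustion and compactness\<close>

locale infinite_positive_schroedinger = positive_schroedinger +
  assumes infinite_V: "infinite V" and connected: "connected_graph V E"
begin

lemma normalised_harmonic_on_finite:
  assumes K: "finite K" "K \<subseteq> V" and p: "p \<in> V"
  obtains u where "\<And>x. u x \<ge> 0" "u p = 1" "\<And>x. x \<in> K \<Longrightarrow> P u x = 0"
proof -
  obtain w where w: "w \<in> V" "w \<notin> K"
    using infinite_V K by (meson finite_subset subsetI)
  have "(adjacent E)\<^sup>*\<^sup>* p w" using connected p w by (simp add: connected_graph_def)
  then obtain z where path: "(\<lambda>x y. x \<in> K \<and> adjacent E x y)\<^sup>*\<^sup>* p z" and zK: "z \<notin> K"
    using rtranclp_exit w(2) by metis
  have "(adjacent E)\<^sup>*\<^sup>* p z" using path by (rule mono_rtranclp[rule_format, rotated]) auto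
  then have zV: "z \<in> V" using p by (rule reachable_in_V)
  obtain v where v: "\<And>x. v x \<ge> 0" "v z > 0" "\<And>x. x \<in> K \<Longrightarrow> P v x = 0"
    using harmonic_with_source[OF K zV zK] by blast
  \<comment> \<open>A zero at \<open>p\<close> would spread through \<open>K\<close> along the path
    to \<open>z\<close>, where \<open>v\<close> is positive.\<close>
  have "v z = 0" if "v p = 0"
    using path
  proof (induction rule: rtranclp_induct)
    case (step y y')
    then show ?case using zero_propagates[of y y' v] v K by (auto simp: neighbours_def)
  qed (fact that)
  then have "v p > 0" using v(1)[of p] v(2) by fastforce
  then show thesis
    using v P_scale[of "1 / v p" v] by (intro that[of "\<lambda>x. 1 / v p * v x"]) simp_all
qed

text \<open>In the product topology, \<open>P u x\<close> is continuous as a finite combination of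
  coordinates of \<open>u\<close>.\<close>

lemma closed_harmonic_at: "closed {u. P u x = 0}"
proof -
  have "continuous_on UNIV (\<lambda>u. P u x)"
    unfolding P_diag by (intro continuous_intros continuous_on_product_coordinates)
  then show ?thesis
    by (intro closed_Collect_eq continuous_on_const)
qed

lemma nonneg_harmonic_exists:
  assumes p: "p \<in> V"
  obtains \<Phi> where "\<And>x. \<Phi> x \<ge> 0" "\<Phi> p = 1" "\<And>x. x \<in> V \<Longrightarrow> P \<Phi> x = 0"
proof -
  have "\<forall>y\<in>V. \<exists>K C. finite K \<and> K \<subseteq> V \<and> C \<ge> 0 \<and>
    (\<forall>u. (\<forall>x. u x \<ge> 0) \<and> u p = 1 \<and> (\<forall>x\<in>K. P u x = 0) \<longrightarrow> u y \<le> C)"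
    using harnack_chain connected p by (simp add: connected_graph_def)
  then obtain K C where KC: "\<And>y. y \<in> V \<Longrightarrow> finite (K y) \<and> K y \<subseteq> V \<and> C y \<ge> 0"
    and bound: "\<And>y u. y \<in> V \<Longrightarrow> (\<And>x. u x \<ge> 0) \<Longrightarrow> u p = 1 \<Longrightarrow>
       (\<And>x. x \<in> K y \<Longrightarrow> P u x = 0) \<Longrightarrow> u y \<le> C y"
    unfolding bchoice_iff by metis
  \<comment> \<open>The singleton at \<open>p\<close> preserves the normalisation in the limit and
    excludes the zero function; off \<open>V\<close> the value is pinned to 0 to keep every factor
    compact.\<close>
  define B :: "'a \<Rightarrow> real set" where
    "B x = (if x = p then {1} else if x \<in> V then {0..C x} else {0})" for x
  have "compactin (product_topology (\<lambda>_. euclidean) UNIV) (PiE UNIV B)"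
    by (subst compactin_PiE) (auto simp: B_def)
  then have compact: "compact (PiE UNIV B)"
    by (simp add: euclidean_product_topology)
  have fip: "PiE UNIV B \<inter> (\<Inter>x\<in>F. {u. P u x = 0}) \<noteq> {}" if F: "finite F" "F \<subseteq> V" for F
  proof -
    \<comment> \<open>\<open>M\<close> contains every coordinate that enters \<open>P u x\<close>
      for \<open>x\<close> in \<open>F\<close>.\<close>
    define M where "M = F \<union> (\<Union>x\<in>F. neighbours E x)"
    have M: "finite M" "M \<subseteq> V"
      using F finite_neighbours neighbours_subset by (auto simp: M_def)
    then have "finite (F \<union> (\<Union>y\<in>M. K y))" "F \<union> (\<Union>y\<in>M. K y) \<subseteq> V" using F KC by auto
    then obtain u where u: "\<And>x. u x \<ge> 0" "u p = 1"
        "\<And>x. x \<in> F \<union> (\<Union>y\<in>M. K y) \<Longrightarrow> P u x = 0"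
      using normalised_harmonic_on_finite p by metis
    \<comment> \<open>The Harnack bounds for \<open>u\<close> are secured only on \<open>M\<close>.
      Truncating to 0 elsewhere, except at \<open>p\<close>, puts the function in the box and does
      not affect \<open>P\<close> on \<open>F\<close>.\<close>
    define u' where "u' x = (if x \<in> insert p M then u x else 0)" for x
    have "u' x \<in> B x" for x
      using u M KC[of x] bound[of x u] by (auto simp: u'_def B_def)
    moreover have "P u' x = 0" if "x \<in> F" for x
    proof -
      have "P u' x = P u x" using that by (intro P_cong) (auto simp: u'_def M_def)
      with u(3) that show ?thesis by simp
    qed
    ultimately have "u' \<in> PiE UNIV B \<inter> (\<Inter>x\<in>F. {u. P u x = 0})" by auto
    then show ?thesis by blast
  qed
  have "PiE UNIV B \<inter> (\<Inter>x\<in>V. {u. P u x = 0}) \<noteq> {}"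
    by (rule compact_imp_fip_image[OF compact closed_harmonic_at fip])
  then obtain \<Phi> where \<Phi>: "\<And>x. \<Phi> x \<in> B x" "\<And>x. x \<in> V \<Longrightarrow> P \<Phi> x = 0" by (auto simp: PiE_iff)
  have "\<Phi> x \<ge> 0" for x using \<Phi>(1)[of x] by (auto simp: B_def split: if_splits)
  moreover have "\<Phi> p = 1" using \<Phi>(1)[of p] by (simp add: B_def)
  ultimately show thesis using that \<Phi>(2) by blast
qed

lemma positive_harmonic_exists: "\<exists>\<Phi>. \<forall>x\<in>V. \<Phi> x > 0 \<and> P \<Phi> x = 0"
proof -
  obtain p where p: "p \<in> V" using infinite_V by fastforce
  obtain \<Phi> where \<Phi>: "\<And>x. \<Phi> x \<ge> 0" "\<Phi> p = 1" "\<And>x. x \<in> V \<Longrightarrow> P \<Phi> x = 0"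
    using nonneg_harmonic_exists[OF p] by blast
  have "\<Phi> x > 0" if x: "x \<in> V" for x
  proof (rule ccontr)
    assume "\<not> \<Phi> x > 0"
    then have zero: "\<Phi> x = 0" using \<Phi>(1)[of x] by simp
    have "(adjacent E)\<^sup>*\<^sup>* x p" using connected p x by (simp add: connected_graph_def)
    \<comment> \<open>\<open>\<Phi>\<close> is harmonic at every vertex of the path, so its zero at
      \<open>x\<close> travels to \<open>p\<close>, against the normalisation.\<close>
    then have "\<Phi> p = 0"
    proof (induction rule: rtranclp_induct)
      case (step y z)
      then show ?case
        using zero_propagates[of y z \<Phi>] \<Phi> reachable_in_V[OF step.hyps(1) x]
        by (auto simp: neighbours_def)
    qed (fact zero)
    with \<Phi>(2) show False by simp
  qed
  with \<Phi>(3) show ?thesis by blast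
qed

end

theorem theorem4p1:
  fixes V :: "'v set" and E :: "'v set set"
    and a :: "'v set \<Rightarrow> real" and W :: "'v \<Rightarrow> real"
  assumes "simple_graph V E"
    and "infinite V"
    and "connected_graph V E"
    and "locally_finite_graph V E"
    and "\<forall>e\<in>E. a e > 0"
    and "\<forall>f \<in> C0 V - {\<lambda>_. 0}. l2_inner V (schroedinger E a W f) f > 0"
  shows "\<exists>\<Phi> :: 'v \<Rightarrow> real. \<forall>x\<in>V. \<Phi> x > 0 \<and> schroedinger E a W \<Phi> x = 0"
proof -
  interpret infinite_positive_schroedinger V E a W
  proof unfold_locales
    show "0 < l2_inner V (schroedinger E a W f) f" if "f \<in> C0 V" "f \<noteq> (\<lambda>_. 0)" for f
      using assms(6) that by blast
  qed (use assms(1-5) in blast)+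
  show ?thesis by (rule positive_harmonic_exists)
qed

end
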